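(* Let $n$ be a positive integer. Let $\mathcal{C}ard(M_2^n,r)$ be the number of isomorphism classes (not necessarily preserving any ordering of the objects) of reduced categories associated to the matrix $M_2^n$. Then lower and upper bounds for $\mathcal{C}ard(M_2^n,r)$ are given by $$\frac{2^{\lfloor n/3\rfloor^3}}{n!}\;\le\;\mathcal{C}ard(M_2^n,r)\;\le\;18^{\binom{n}{3}}.$$
   Context: $M_2^n$ is the $n\times n$ matrix all of whose coefficients equal $2$. A category $\mathcal{A}$ is associated to $M_2^n$ if it has exactly $n$ objects $\lambda^1,\dots,\lambda^n$ and every hom set $\mathcal{A}(\lambda^i,\lambda^j)$, $1\le i,j\le n$ (including $i=j$), has exactly $2$ elements. Such a category is reduced if no two distinct objects are isomorphic. An isomorphism of categories is a functor that is bijective on objects and on morphisms.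
   Formalization: The upper bound is stated only for n ≥ 2, because for n = 1 it fails: the two monoids of order 2 give two non-isomorphic reduced categories associated to the matrix, whereas 18^{binom(1,3)} = 1; the lower bound is stated for every positive integer n. *)

theory Defs
  imports Complex_Main
begin

record ('o, 'm) cat =
  Ob :: "'o set"
  Mor :: "'m set"
  src :: "'m \<Rightarrow> 'o"
  trg :: "'m \<Rightarrow> 'o"
  ident :: "'o \<Rightarrow> 'm"
  cmp :: "'m \<Rightarrow> 'm \<Rightarrow> 'm"  (* cmp C g f is "g after f" *)

definition hom_set :: "('o, 'm) cat \<Rightarrow> 'o \<Rightarrow> 'o \<Rightarrow> 'm set" where
  "hom_set C x y = {f \<in> Mor C. src C f = x \<and> trg C f = y}"

locale category =
  fixes C :: "('o, 'm) cat"
  assumes src_in_Ob: "f \<in> Mor C \<Longrightarrow> src C f \<in> Ob C"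
    and trg_in_Ob: "f \<in> Mor C \<Longrightarrow> trg C f \<in> Ob C"
    and ident_in_hom: "x \<in> Ob C \<Longrightarrow> ident C x \<in> hom_set C x x"
    and comp_in_hom: "\<lbrakk>f \<in> hom_set C x y; g \<in> hom_set C y z\<rbrakk> \<Longrightarrow> cmp C g f \<in> hom_set C x z"
    and comp_ident_right: "f \<in> hom_set C x y \<Longrightarrow> cmp C f (ident C x) = f"
    and comp_ident_left: "f \<in> hom_set C x y \<Longrightarrow> cmp C (ident C y) f = f"
    and comp_assoc: "\<lbrakk>f \<in> hom_set C w x; g \<in> hom_set C x y; h \<in> hom_set C y z\<rbrakk>
      \<Longrightarrow> cmp C h (cmp C g f) = cmp C (cmp C h g) f"

definition isomorphic_objects :: "('o, 'm) cat \<Rightarrow> 'o \<Rightarrow> 'o \<Rightarrow> bool" where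
  "isomorphic_objects C x y \<longleftrightarrow>
    (\<exists>f \<in> hom_set C x y. \<exists>g \<in> hom_set C y x. cmp C g f = ident C x \<and> cmp C f g = ident C y)"

definition reduced :: "('o, 'm) cat \<Rightarrow> bool" where
  "reduced C \<longleftrightarrow> (\<forall>x \<in> Ob C. \<forall>y \<in> Ob C. x \<noteq> y \<longrightarrow> \<not> isomorphic_objects C x y)"

definition is_functor ::
    "('o, 'm) cat \<Rightarrow> ('p, 'q) cat \<Rightarrow> ('o \<Rightarrow> 'p) \<Rightarrow> ('m \<Rightarrow> 'q) \<Rightarrow> bool" where
  "is_functor C D F0 F1 \<longleftrightarrow>
    (\<forall>x \<in> Ob C. F0 x \<in> Ob D) \<and>
    (\<forall>x \<in> Ob C. \<forall>y \<in> Ob C. \<forall>f \<in> hom_set C x y. F1 f \<in> hom_set D (F0 x) (F0 y)) \<and>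
    (\<forall>x \<in> Ob C. F1 (ident C x) = ident D (F0 x)) \<and>
    (\<forall>x \<in> Ob C. \<forall>y \<in> Ob C. \<forall>z \<in> Ob C. \<forall>f \<in> hom_set C x y. \<forall>g \<in> hom_set C y z.
       F1 (cmp C g f) = cmp D (F1 g) (F1 f))"

definition isomorphic_cats :: "('o, 'm) cat \<Rightarrow> ('p, 'q) cat \<Rightarrow> bool" where
  "isomorphic_cats C D \<longleftrightarrow>
    (\<exists>F0 F1. is_functor C D F0 F1 \<and> bij_betw F0 (Ob C) (Ob D) \<and> bij_betw F1 (Mor C) (Mor D))"

(* An n x n matrix of natural numbers is a function of which only the entries with
   indices in {1..n} are used. The enumeration of the objects is existentially
   quantified and is not part of the data of the category. *)
definition associated :: "nat \<Rightarrow> (nat \<Rightarrow> nat \<Rightarrow> nat) \<Rightarrow> ('o, 'm) cat \<Rightarrow> bool" where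
  "associated n M C \<longleftrightarrow> category C \<and>
    (\<exists>l. bij_betw l {1..n} (Ob C) \<and>
      (\<forall>i \<in> {1..n}. \<forall>j \<in> {1..n}.
         finite (hom_set C (l i) (l j)) \<and> card (hom_set C (l i) (l j)) = M i j))"

definition M2 :: "nat \<Rightarrow> nat \<Rightarrow> nat" where
  "M2 i j = 2"

(* Every finite category is isomorphic to one whose objects and morphisms are natural
   numbers, so this universe contains a representative of each isomorphism class.
   Values of the structure maps outside Ob and Mor are irrelevant: categories that
   differ only there are isomorphic. *)
definition reduced_cats :: "nat \<Rightarrow> (nat \<Rightarrow> nat \<Rightarrow> nat) \<Rightarrow> (nat, nat) cat set" where
  "reduced_cats n M = {C. associated n M C \<and> reduced C}"

definition iso_rel :: "nat \<Rightarrow> (nat \<Rightarrow> nat \<Rightarrow> nat) \<Rightarrow> ((nat, nat) cat \<times> (nat, nat) cat) set" where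
  "iso_rel n M = {(C, D). C \<in> reduced_cats n M \<and> D \<in> reduced_cats n M \<and> isomorphic_cats C D}"

(* Card_reduced 1 M2 = 2, because the two monoids of order 2 are non-isomorphic
   reduced categories, whereas 18 ^ (1 choose 3) = 1. *)
definition Card_reduced :: "nat \<Rightarrow> (nat \<Rightarrow> nat \<Rightarrow> nat) \<Rightarrow> nat" where
  "Card_reduced n M = card (reduced_cats n M // iso_rel n M)"

end

theory Submission
  imports Defs "HOL-Library.Nat_Bijection" "HOL-Library.FuncSet" "HOL-Combinatorics.Permutations"
begin

text \<open>
  A reduced category with two-element hom sets and at least two objects carries very little
  information. No composite \<open>x \<rightarrow> y \<rightarrow> x\<close> with \<open>x \<noteq> y\<close> is an identity (\<open>comp_ne_ident\<close>), so it is
  the other endomorphism of \<open>x\<close>, which is then idempotent. Composing with these idempotents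
  singles out one zero morphism in every hom set, and the zeros form an ideal
  (\<open>comp_zero\<close>). Call the remaining morphism of each hom set its unit; the unit of \<open>x \<rightarrow> x\<close> is
  the identity. The composite of two units is a unit or zero, so after numbering the objects the
  category is determined by the set \<open>T\<close> of triples \<open>(i, j, k)\<close> of distinct indices along which the
  units compose to a unit. Associativity becomes the condition \<open>coherent\<close> on \<open>T\<close>, and
  conversely every coherent \<open>T\<close> comes from a category \<open>triple_cat n T\<close>.

  Upper bound. Coherence for the quadruples \<open>(i, j, i, k)\<close> and \<open>(i, j, k, j)\<close> forbids \<open>T\<close> from
  containing two orderings of the same three indices that differ by an adjacent transposition
  (\<open>coherent_triangle\<close>). The six orderings of a 3-set, joined by adjacent transpositions, form a
  hexagon, and a hexagon has 18 independent sets. So each of the \<open>n choose 3\<close> subsets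
  of size 3 leaves at most 18 choices.

  Lower bound. Take disjoint sets \<open>A\<close>, \<open>B\<close>, \<open>D\<close> of \<open>n div 3\<close> indices each. Every subset of
  \<open>A \<times> B \<times> D\<close> is coherent, because in such a set of triples no product of three units can be
  nonzero unless one of them is an identity. This gives \<open>2 ^ ((n div 3) ^ 3)\<close> categories. An
  isomorphism between two of them preserves zeros and units, hence arises from a permutation of
  the indices (\<open>triple_cat_iso_imp_relabelling\<close>), so an isomorphism class contains at most \<open>n!\<close> of them.

  Because \<open>card\<close> is 0 on infinite sets, the lower bound also needs that there are finitely many
  classes. For \<open>n \<ge> 2\<close> the upper bound argument shows this; for \<open>n = 1\<close>, where the group of order 2
  is a further category that is not of the form above, it is proved separately
  (\<open>finite_classes_one\<close>).
\<close>

section \<open>Isomorphism of categories is an equivalence\<close>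

lemma hom_setD: "f \<in> hom_set C x y \<Longrightarrow> f \<in> Mor C \<and> src C f = x \<and> trg C f = y"
  by (simp add: hom_set_def)

lemma isomorphic_cats_refl: "isomorphic_cats C C"
  unfolding isomorphic_cats_def is_functor_def
  by (rule exI[of _ id], rule exI[of _ id]) auto

lemma isomorphic_cats_trans:
  assumes "isomorphic_cats C D" "isomorphic_cats D E"
  shows "isomorphic_cats C E"
proof -
  from assms obtain F0 F1 G0 G1 where
    F: "is_functor C D F0 F1" "bij_betw F0 (Ob C) (Ob D)" "bij_betw F1 (Mor C) (Mor D)" and
    G: "is_functor D E G0 G1" "bij_betw G0 (Ob D) (Ob E)" "bij_betw G1 (Mor D) (Mor E)"
    unfolding isomorphic_cats_def by blast
  have "is_functor C E (G0 \<circ> F0) (G1 \<circ> F1)"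
    unfolding is_functor_def comp_def
  proof (intro conjI ballI)
    fix x y z f g assume *: "x \<in> Ob C" "y \<in> Ob C" "z \<in> Ob C"
      "f \<in> hom_set C x y" "g \<in> hom_set C y z"
    have "F0 x \<in> Ob D" "F0 y \<in> Ob D" "F0 z \<in> Ob D"
      "F1 f \<in> hom_set D (F0 x) (F0 y)" "F1 g \<in> hom_set D (F0 y) (F0 z)"
      "F1 (cmp C g f) = cmp D (F1 g) (F1 f)"
      using F(1) * unfolding is_functor_def by blast+
    then show "G1 (F1 (cmp C g f)) = cmp E (G1 (F1 g)) (G1 (F1 f))"
      using G(1) unfolding is_functor_def by metis
  qed (use F(1) G(1) in \<open>auto simp: is_functor_def\<close>)
  moreover have "bij_betw (G0 \<circ> F0) (Ob C) (Ob E)" "bij_betw (G1 \<circ> F1) (Mor C) (Mor E)"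
    using F G bij_betw_trans by blast+
  ultimately show ?thesis unfolding isomorphic_cats_def by blast
qed

lemma isomorphic_cats_sym:
  assumes "category C" "category D" "isomorphic_cats C D"
  shows "isomorphic_cats D C"
proof -
  interpret C: category C by fact
  interpret D: category D by fact
  from assms obtain F0 F1 where
    F: "is_functor C D F0 F1" and b0: "bij_betw F0 (Ob C) (Ob D)" and b1: "bij_betw F1 (Mor C) (Mor D)"
    unfolding isomorphic_cats_def by blast
  define G0 where "G0 = the_inv_into (Ob C) F0"
  define G1 where "G1 = the_inv_into (Mor C) F1"
  have g0: "bij_betw G0 (Ob D) (Ob C)" and g1: "bij_betw G1 (Mor D) (Mor C)"
    unfolding G0_def G1_def using b0 b1 by (auto intro: bij_betw_the_inv_into)
  have FG0: "F0 (G0 x) = x" "G0 x \<in> Ob C" if "x \<in> Ob D" for x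
    using that b0 g0 unfolding G0_def by (auto simp: f_the_inv_into_f_bij_betw bij_betw_apply)
  have FG1: "F1 (G1 x) = x" "G1 x \<in> Mor C" if "x \<in> Mor D" for x
    using that b1 g1 unfolding G1_def by (auto simp: f_the_inv_into_f_bij_betw bij_betw_apply)
  have GF0: "G0 (F0 x) = x" if "x \<in> Ob C" for x
    using that b0 unfolding G0_def by (auto simp: the_inv_into_f_f bij_betw_def)
  have GF1: "G1 (F1 x) = x" if "x \<in> Mor C" for x
    using that b1 unfolding G1_def by (auto simp: the_inv_into_f_f bij_betw_def)
  have hom: "G1 f \<in> hom_set C (G0 x) (G0 y)" if f: "f \<in> hom_set D x y" for f x y
  proof -
    have m: "G1 f \<in> Mor C" "F1 (G1 f) = f" using f FG1 by (auto simp: hom_set_def)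
    let ?s = "src C (G1 f)" and ?t = "trg C (G1 f)"
    have st: "?s \<in> Ob C" "?t \<in> Ob C" using m C.src_in_Ob C.trg_in_Ob by auto
    have "G1 f \<in> hom_set C ?s ?t" using m by (simp add: hom_set_def)
    then have "f \<in> hom_set D (F0 ?s) (F0 ?t)" using F st m unfolding is_functor_def by metis
    then have "x = F0 ?s" "y = F0 ?t" using f by (auto simp: hom_set_def)
    then show ?thesis using GF0 st m by (simp add: hom_set_def)
  qed
  have "is_functor D C G0 G1"
    unfolding is_functor_def
  proof (intro conjI ballI)
    fix x assume x: "x \<in> Ob D"
    have "F1 (ident C (G0 x)) = ident D x" using F FG0 x unfolding is_functor_def by metis
    moreover have "ident C (G0 x) \<in> Mor C" using C.ident_in_hom FG0 x hom_setD by metis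
    ultimately show "G1 (ident D x) = ident C (G0 x)" using GF1 by metis
  next
    fix x y z f g assume *: "x \<in> Ob D" "y \<in> Ob D" "z \<in> Ob D"
      "f \<in> hom_set D x y" "g \<in> hom_set D y z"
    have h: "G1 f \<in> hom_set C (G0 x) (G0 y)" "G1 g \<in> hom_set C (G0 y) (G0 z)" using hom * by auto
    have "F1 (G1 f) = f" "F1 (G1 g) = g" using FG1 * by (auto simp: hom_set_def)
    then have "F1 (cmp C (G1 g) (G1 f)) = cmp D g f"
      using F h FG0 * unfolding is_functor_def by metis
    moreover have "cmp C (G1 g) (G1 f) \<in> Mor C" using C.comp_in_hom h hom_setD by metis
    ultimately show "G1 (cmp D g f) = cmp C (G1 g) (G1 f)" using GF1 by metis
  qed (use FG0 hom in auto)
  then show ?thesis using g0 g1 unfolding isomorphic_cats_def by blast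
qed

lemma equiv_iso_rel: "equiv (reduced_cats n M) (iso_rel n M)"
proof (rule equivI)
  show "iso_rel n M \<subseteq> reduced_cats n M \<times> reduced_cats n M" by (auto simp: iso_rel_def)
  show "refl_on (reduced_cats n M) (iso_rel n M)"
    by (auto simp: refl_on_def iso_rel_def isomorphic_cats_refl)
  show "sym (iso_rel n M)"
    by (auto simp: sym_def iso_rel_def reduced_cats_def associated_def intro: isomorphic_cats_sym)
  show "trans (iso_rel n M)"
    by (auto simp: trans_def iso_rel_def intro: isomorphic_cats_trans)
qed

text \<open>An invariant that separates the classes gives an upper bound for their number. Finiteness is
  part of the conclusion because \<open>card\<close> alone would not exclude infinitely many classes.\<close>

lemma quotient_card_le:
  assumes "equiv A r" "finite B" "\<And>x. x \<in> A \<Longrightarrow> \<phi> x \<in> B"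
    and "\<And>x y. x \<in> A \<Longrightarrow> y \<in> A \<Longrightarrow> \<phi> x = \<phi> y \<Longrightarrow> (x, y) \<in> r"
  shows "finite (A // r) \<and> card (A // r) \<le> card B"
proof -
  define h where "h b = r `` {SOME x. x \<in> A \<and> \<phi> x = b}" for b
  have "A // r \<subseteq> h ` B"
  proof
    fix c assume "c \<in> A // r"
    then obtain x where x: "x \<in> A" "c = r `` {x}" by (auto simp: quotient_def)
    let ?y = "SOME y. y \<in> A \<and> \<phi> y = \<phi> x"
    have "?y \<in> A \<and> \<phi> ?y = \<phi> x" by (rule someI[of _ x]) (use x in auto)
    then have "r `` {?y} = r `` {x}" using assms x equiv_class_eq by metis
    then show "c \<in> h ` B" using x assms(3) by (auto simp: h_def)
  qed
  then show ?thesis using assms(2) by (meson card_image_le card_mono finite_imageI finite_subset le_trans)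
qed

text \<open>A family that meets each class at most \<open>N\<close> times is covered by the fibres over the classes.\<close>

lemma card_le_mult_quotient:
  assumes "equiv A r" "finite (A // r)" "\<And>x. x \<in> L \<Longrightarrow> f x \<in> A"
    and fib: "\<And>x. x \<in> L \<Longrightarrow> card {y \<in> L. (f x, f y) \<in> r} \<le> N"
  shows "card L \<le> N * card (A // r)"
proof -
  have "L = (\<Union>c \<in> A // r. {y \<in> L. f y \<in> c})"
    using quotientI[of "f _" A r] equiv_class_self[OF assms(1)] assms(3) by blast
  then have "card L \<le> (\<Sum>c \<in> A // r. card {y \<in> L. f y \<in> c})"
    using card_UN_le[OF assms(2)] by metis
  also have "\<dots> \<le> (\<Sum>c \<in> A // r. N)"
  proof (rule sum_mono)
    fix c assume c: "c \<in> A // r"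
    show "card {y \<in> L. f y \<in> c} \<le> N"
    proof (cases "{y \<in> L. f y \<in> c} = {}")
      case False
      then obtain x where x: "x \<in> L" "f x \<in> c" by auto
      then have "c = r `` {f x}"
        using c assms(1) by (metis Image_singleton_iff equiv_class_eq quotientE)
      then show ?thesis using fib[OF x(1)] by simp
    next
      case True
      then show ?thesis by (metis card.empty le0)
    qed
  qed
  finally show ?thesis by (simp add: mult.commute)
qed

section \<open>The category of a set of ordered triples\<close>

text \<open>The morphisms must be natural numbers, so the zero (\<open>False\<close>) and the unit (\<open>True\<close>) of
  \<open>i \<rightarrow> j\<close> are coded by pairing.\<close>

definition arrow :: "nat \<Rightarrow> nat \<Rightarrow> bool \<Rightarrow> nat" where
  "arrow i j b = prod_encode (i, prod_encode (j, of_bool b))"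

definition arrow_src :: "nat \<Rightarrow> nat" where
  "arrow_src f = fst (prod_decode f)"

definition arrow_trg :: "nat \<Rightarrow> nat" where
  "arrow_trg f = fst (prod_decode (snd (prod_decode f)))"

definition arrow_flag :: "nat \<Rightarrow> bool" where
  "arrow_flag f \<longleftrightarrow> snd (prod_decode (snd (prod_decode f))) = 1"

lemma arrow_simps [simp]:
  "arrow_src (arrow i j b) = i" "arrow_trg (arrow i j b) = j" "arrow_flag (arrow i j b) = b"
  by (simp_all add: arrow_def arrow_src_def arrow_trg_def arrow_flag_def)

lemma arrow_eq_iff [simp]: "arrow i j b = arrow i' j' b' \<longleftrightarrow> i = i' \<and> j = j' \<and> b = b'"
  by (simp add: arrow_def)

text \<open>The degenerate cases \<open>i = j\<close> and \<open>j = k\<close> are those in which one of the two units is an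
  identity. The case \<open>i = k\<close> is absent: as \<open>T\<close> will consist of triples of distinct indices,
  going out and back gives zero.\<close>

definition units_compose :: "(nat \<times> nat \<times> nat) set \<Rightarrow> nat \<Rightarrow> nat \<Rightarrow> nat \<Rightarrow> bool" where
  "units_compose T i j k \<longleftrightarrow> i = j \<or> j = k \<or> (i, j, k) \<in> T"

definition triple_cat :: "nat \<Rightarrow> (nat \<times> nat \<times> nat) set \<Rightarrow> (nat, nat) cat" where
  "triple_cat n T = \<lparr>Ob = {1..n}, Mor = {arrow i j b | i j b. i \<in> {1..n} \<and> j \<in> {1..n}},
     src = arrow_src, trg = arrow_trg, ident = (\<lambda>i. arrow i i True),
     cmp = (\<lambda>g f. arrow (arrow_src f) (arrow_trg g)
       (arrow_flag f \<and> arrow_flag g \<and> units_compose T (arrow_src f) (arrow_trg f) (arrow_trg g)))\<rparr>"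

definition distinct_triples :: "nat \<Rightarrow> (nat \<times> nat \<times> nat) set" where
  "distinct_triples n = {(i, j, k). i \<in> {1..n} \<and> j \<in> {1..n} \<and> k \<in> {1..n} \<and> i \<noteq> j \<and> j \<noteq> k \<and> i \<noteq> k}"

text \<open>The equivalence says that the two ways of composing the units along \<open>i \<rightarrow> j \<rightarrow> k \<rightarrow> l\<close> agree.\<close>

definition coherent :: "nat \<Rightarrow> (nat \<times> nat \<times> nat) set \<Rightarrow> bool" where
  "coherent n T \<longleftrightarrow> T \<subseteq> distinct_triples n \<and>
    (\<forall>i \<in> {1..n}. \<forall>j \<in> {1..n}. \<forall>k \<in> {1..n}. \<forall>l \<in> {1..n}.
       (units_compose T i j k \<and> units_compose T i k l \<longleftrightarrow> units_compose T j k l \<and> units_compose T i j l))"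

lemma triple_cat_simps [simp]:
  "Ob (triple_cat n T) = {1..n}"
  "Mor (triple_cat n T) = {arrow i j b | i j b. i \<in> {1..n} \<and> j \<in> {1..n}}"
  "ident (triple_cat n T) i = arrow i i True"
  "cmp (triple_cat n T) (arrow j' k b') (arrow i j b) = arrow i k (b \<and> b' \<and> units_compose T i j k)"
  by (simp_all add: triple_cat_def)

lemma hom_set_triple_cat:
  "hom_set (triple_cat n T) i j = (if i \<in> {1..n} \<and> j \<in> {1..n} then {arrow i j b | b. True} else {})"
  by (auto simp: hom_set_def triple_cat_def)

lemma category_triple_cat:
  assumes "coherent n T"
  shows "category (triple_cat n T)"
proof
  fix f assume "f \<in> Mor (triple_cat n T)"
  then show "src (triple_cat n T) f \<in> Ob (triple_cat n T)" "trg (triple_cat n T) f \<in> Ob (triple_cat n T)"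
    by (auto simp: triple_cat_def)
next
  fix f g h w x y z
  assume *: "f \<in> hom_set (triple_cat n T) w x" "g \<in> hom_set (triple_cat n T) x y"
    "h \<in> hom_set (triple_cat n T) y z"
  then have "w \<in> {1..n}" "x \<in> {1..n}" "y \<in> {1..n}" "z \<in> {1..n}"
    by (auto simp: hom_set_triple_cat split: if_splits)
  then have "units_compose T w x y \<and> units_compose T w y z \<longleftrightarrow> units_compose T x y z \<and> units_compose T w x z"
    using assms unfolding coherent_def by blast
  then show "cmp (triple_cat n T) h (cmp (triple_cat n T) g f) = cmp (triple_cat n T) (cmp (triple_cat n T) h g) f"
    using * by (auto simp: hom_set_triple_cat split: if_splits)
qed (auto simp: hom_set_triple_cat units_compose_def split: if_splits)

lemma triple_cat_in_reduced_cats: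
  assumes "coherent n T"
  shows "triple_cat n T \<in> reduced_cats n M2"
proof -
  have hom: "hom_set (triple_cat n T) i j = {arrow i j False, arrow i j True}"
    if "i \<in> {1..n}" "j \<in> {1..n}" for i j
    using that by (auto simp: hom_set_triple_cat)
  have "associated n M2 (triple_cat n T)"
    unfolding associated_def using category_triple_cat[OF assms]
    by (intro conjI exI[of _ id]) (auto simp: hom M2_def)
  moreover have "reduced (triple_cat n T)"
    unfolding reduced_def isomorphic_objects_def
  proof (intro ballI impI notI)
    fix x y assume xy: "x \<in> Ob (triple_cat n T)" "y \<in> Ob (triple_cat n T)" "x \<noteq> y"
    have "\<not> units_compose T x y x"
      using assms xy by (auto simp: coherent_def units_compose_def distinct_triples_def)
    moreover assume "\<exists>f\<in>hom_set (triple_cat n T) x y. \<exists>g\<in>hom_set (triple_cat n T) y x.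
      cmp (triple_cat n T) g f = ident (triple_cat n T) x \<and> cmp (triple_cat n T) f g = ident (triple_cat n T) y"
    ultimately show False using xy by (auto simp: hom_set_triple_cat)
  qed
  ultimately show ?thesis by (simp add: reduced_cats_def)
qed

text \<open>An isomorphism preserves identities, so it preserves the other endomorphism of each object,
  which is zero. The zero of \<open>i \<rightarrow> j\<close> is the composite of itself with the zero endomorphism of \<open>i\<close>,
  so all zeros are preserved; by injectivity so are the units, and therefore the relation that says
  which units compose to units.\<close>

lemma triple_cat_iso_imp_relabelling:
  assumes T: "T \<subseteq> distinct_triples n" and T': "T' \<subseteq> distinct_triples n"
    and iso: "isomorphic_cats (triple_cat n T) (triple_cat n T')"
  obtains \<sigma> where "\<sigma> permutes {1..n}" "T' = (\<lambda>(i, j, k). (\<sigma> i, \<sigma> j, \<sigma> k)) ` T"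
proof -
  let ?C = "triple_cat n T" and ?D = "triple_cat n T'"
  from iso obtain F0 F1 where F: "is_functor ?C ?D F0 F1"
    and b0: "bij_betw F0 {1..n} {1..n}" and b1: "bij_betw F1 (Mor ?C) (Mor ?D)"
    unfolding isomorphic_cats_def by auto
  have inj: "F1 f = F1 g \<longleftrightarrow> f = g" if "f \<in> Mor ?C" "g \<in> Mor ?C" for f g
    using that by (rule inj_on_eq_iff[OF bij_betw_imp_inj_on[OF b1]])
  have ne: "F1 (arrow i j True) \<noteq> F1 (arrow i j False)" if "i \<in> {1..n}" "j \<in> {1..n}" for i j
    using inj[of "arrow i j True" "arrow i j False"] that by auto
  have F0: "F0 i \<in> {1..n}" if "i \<in> {1..n}" for i using b0 that bij_betw_apply by metis
  have hom: "\<exists>c. F1 (arrow i j b) = arrow (F0 i) (F0 j) c" if "i \<in> {1..n}" "j \<in> {1..n}" for i j b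
  proof -
    have "arrow i j b \<in> hom_set ?C i j" using that by (auto simp: hom_set_triple_cat)
    then have "F1 (arrow i j b) \<in> hom_set ?D (F0 i) (F0 j)"
      using F that unfolding is_functor_def by (metis triple_cat_simps(1))
    then show ?thesis using that F0 by (auto simp: hom_set_triple_cat)
  qed
  have comp: "F1 (cmp ?C (arrow j k b') (arrow i j b)) = cmp ?D (F1 (arrow j k b')) (F1 (arrow i j b))"
    if "i \<in> {1..n}" "j \<in> {1..n}" "k \<in> {1..n}" for i j k b b'
  proof -
    have "arrow i j b \<in> hom_set ?C i j" "arrow j k b' \<in> hom_set ?C j k"
      using that by (auto simp: hom_set_triple_cat)
    then show ?thesis using F that unfolding is_functor_def by (metis triple_cat_simps(1))
  qed
  have id: "F1 (arrow i i True) = arrow (F0 i) (F0 i) True" if "i \<in> {1..n}" for i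
    using F that by (auto simp: is_functor_def)
  have zero_end: "F1 (arrow i i False) = arrow (F0 i) (F0 i) False" if i: "i \<in> {1..n}" for i
  proof -
    obtain c where "F1 (arrow i i False) = arrow (F0 i) (F0 i) c" using hom[OF i i] by blast
    then show ?thesis using id[OF i] ne[OF i i] by (cases c) auto
  qed
  have zero: "F1 (arrow i j False) = arrow (F0 i) (F0 j) False" if ij: "i \<in> {1..n}" "j \<in> {1..n}" for i j
  proof -
    obtain c where "F1 (arrow i j False) = arrow (F0 i) (F0 j) c" using hom[OF ij] by blast
    then show ?thesis
      using comp[of i i j False False] zero_end[OF ij(1)] ij by simp
  qed
  have F1: "F1 (arrow i j b) = arrow (F0 i) (F0 j) b" if ij: "i \<in> {1..n}" "j \<in> {1..n}" for i j b
  proof (cases b)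
    case True
    obtain c where "F1 (arrow i j True) = arrow (F0 i) (F0 j) c" using hom[OF ij] by blast
    then show ?thesis using ne[OF ij] zero[OF ij] True by (cases c) auto
  qed (use zero ij in simp)
  have uc: "units_compose T i j k \<longleftrightarrow> units_compose T' (F0 i) (F0 j) (F0 k)"
    if ijk: "i \<in> {1..n}" "j \<in> {1..n}" "k \<in> {1..n}" for i j k
    using comp[OF ijk, of True True] ijk by (simp add: F1)
  have F0eq: "F0 i = F0 j \<longleftrightarrow> i = j" if "i \<in> {1..n}" "j \<in> {1..n}" for i j
    using that by (rule inj_on_eq_iff[OF bij_betw_imp_inj_on[OF b0]])
  have mem: "(i, j, k) \<in> T \<longleftrightarrow> (F0 i, F0 j, F0 k) \<in> T'"
    if ijk: "i \<in> {1..n}" "j \<in> {1..n}" "k \<in> {1..n}" for i j k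
  proof (cases "i = j \<or> j = k")
    case True
    then show ?thesis using T T' by (auto simp: distinct_triples_def)
  next
    case False
    then show ?thesis using uc[OF ijk] F0eq ijk by (simp add: units_compose_def)
  qed
  define \<sigma> where "\<sigma> i = (if i \<in> {1..n} then F0 i else i)" for i
  have \<sigma>: "\<sigma> i = F0 i" if "i \<in> {1..n}" for i using that by (simp add: \<sigma>_def)
  show thesis
  proof
    have "bij_betw \<sigma> {1..n} {1..n}" using bij_betw_cong[of "{1..n}" \<sigma> F0 "{1..n}"] \<sigma> b0 by simp
    then show "\<sigma> permutes {1..n}" by (rule bij_imp_permutes) (auto simp: \<sigma>_def)
    show "T' = (\<lambda>(i, j, k). (\<sigma> i, \<sigma> j, \<sigma> k)) ` T"
    proof (rule set_eqI, rule iffI)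
      fix t assume t: "t \<in> T'"
      then obtain a b c where abc: "t = (a, b, c)" "a \<in> {1..n}" "b \<in> {1..n}" "c \<in> {1..n}"
        using T' by (auto simp: distinct_triples_def)
      obtain i j k where ijk: "i \<in> {1..n}" "j \<in> {1..n}" "k \<in> {1..n}" "a = F0 i" "b = F0 j" "c = F0 k"
      proof -
        have "a \<in> F0 ` {1..n}" "b \<in> F0 ` {1..n}" "c \<in> F0 ` {1..n}"
          using abc(2-4) by (simp_all only: bij_betw_imp_surj_on[OF b0])
        then show ?thesis using that by (elim imageE)
      qed
      have "(i, j, k) \<in> T" using mem t abc ijk by blast
      then show "t \<in> (\<lambda>(i, j, k). (\<sigma> i, \<sigma> j, \<sigma> k)) ` T"
        using abc(1) ijk \<sigma> by (intro image_eqI[of _ _ "(i, j, k)"]) auto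
    next
      fix t assume "t \<in> (\<lambda>(i, j, k). (\<sigma> i, \<sigma> j, \<sigma> k)) ` T"
      then obtain i j k where ijk: "(i, j, k) \<in> T" "t = (\<sigma> i, \<sigma> j, \<sigma> k)" by auto
      then have "i \<in> {1..n}" "j \<in> {1..n}" "k \<in> {1..n}" using T by (auto simp: distinct_triples_def)
      then show "t \<in> T'" using mem ijk \<sigma> by simp
    qed
  qed
qed

section \<open>Reduced categories with two-element hom sets\<close>

text \<open>Two objects are needed: the group of order 2 is a category with one object and a two-element
  hom set whose second endomorphism is not idempotent.\<close>

locale two_hom_category = category C for C :: "('o, 'm) cat" +
  assumes card_hom: "\<lbrakk>x \<in> Ob C; y \<in> Ob C\<rbrakk> \<Longrightarrow> card (hom_set C x y) = 2"
    and reduced: "reduced C"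
    and two_objects: "x \<in> Ob C \<Longrightarrow> \<exists>y \<in> Ob C. y \<noteq> x"
begin

abbreviation hom where "hom \<equiv> hom_set C"
abbreviation comp (infixl "\<cdot>" 70) where "g \<cdot> f \<equiv> cmp C g f"
abbreviation one where "one \<equiv> ident C"

lemma hom_nonempty: "\<lbrakk>x \<in> Ob C; y \<in> Ob C\<rbrakk> \<Longrightarrow> \<exists>f. f \<in> hom x y"
  using card_hom by (metis card.empty ex_in_conv zero_neq_numeral)

lemma hom_other: "\<lbrakk>x \<in> Ob C; y \<in> Ob C; f \<in> hom x y\<rbrakk> \<Longrightarrow> \<exists>g. g \<noteq> f \<and> hom x y = {f, g}"
  using card_hom[of x y] by (auto simp: card_2_iff)

text \<open>Suppose \<open>g \<cdot> f = 1\<close>. Since \<open>x\<close> and \<open>y\<close> are not isomorphic, \<open>f \<cdot> g\<close> is the second endomorphism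
  of \<open>y\<close>. Let \<open>e\<close> be the second endomorphism of \<open>x\<close>. The map \<open>h \<mapsto> g \<cdot> h \<cdot> f\<close> sends \<open>f \<cdot> e \<cdot> g\<close>
  back to \<open>e\<close>, but it sends both endomorphisms \<open>1\<close> and \<open>f \<cdot> g\<close> of \<open>y\<close> to \<open>1\<close>.\<close>

lemma comp_ne_ident:
  assumes x: "x \<in> Ob C" and y: "y \<in> Ob C" and ne: "x \<noteq> y" and f: "f \<in> hom x y" and g: "g \<in> hom y x"
  shows "g \<cdot> f \<noteq> one x"
proof
  assume gf: "g \<cdot> f = one x"
  obtain e where e: "e \<noteq> one x" "hom x x = {one x, e}"
    using hom_other[OF x x ident_in_hom[OF x]] by blast
  have eh: "e \<in> hom x x" using e by simp
  have fg: "f \<cdot> g \<noteq> one y"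
    using reduced x y ne f g gf unfolding reduced_def isomorphic_objects_def by blast
  have hyy: "hom y y = {one y, f \<cdot> g}"
    using hom_other[OF y y ident_in_hom[OF y]] comp_in_hom[OF g f] fg by auto
  have feg: "f \<cdot> (e \<cdot> g) \<in> hom y y" using comp_in_hom[OF comp_in_hom[OF g eh] f] .
  have "g \<cdot> (f \<cdot> (e \<cdot> g)) = (g \<cdot> f) \<cdot> (e \<cdot> g)" using comp_assoc[OF comp_in_hom[OF g eh] f g] .
  also have "\<dots> = e \<cdot> g" using gf comp_ident_left comp_in_hom[OF g eh] by simp
  finally have "(g \<cdot> (f \<cdot> (e \<cdot> g))) \<cdot> f = e \<cdot> (g \<cdot> f)" using comp_assoc[OF f g eh] by simp
  then have 1: "(g \<cdot> (f \<cdot> (e \<cdot> g))) \<cdot> f = e" using gf comp_ident_right eh by simp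
  have 2: "(g \<cdot> one y) \<cdot> f = one x" using comp_ident_right g gf by simp
  have "(g \<cdot> (f \<cdot> g)) = g" using comp_assoc[OF g f g] gf comp_ident_left g by simp
  then have 3: "(g \<cdot> (f \<cdot> g)) \<cdot> f = one x" using gf by simp
  show False using 1 2 3 feg hyy e(1) by auto
qed

definition idem :: "'o \<Rightarrow> 'm" where
  "idem x = (THE e. e \<in> hom x x \<and> e \<noteq> one x)"

lemma idem: 
  assumes x: "x \<in> Ob C"
  shows "idem x \<in> hom x x" "idem x \<noteq> one x" "f \<in> hom x x \<Longrightarrow> f \<noteq> one x \<Longrightarrow> f = idem x"
proof -
  obtain e where e: "e \<noteq> one x" "hom x x = {one x, e}"
    using hom_other[OF x x ident_in_hom[OF x]] by blast
  have "idem x = e" unfolding idem_def by (rule the_equality) (use e in auto)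
  then show "idem x \<in> hom x x" "idem x \<noteq> one x" "f \<in> hom x x \<Longrightarrow> f \<noteq> one x \<Longrightarrow> f = idem x"
    using e by auto
qed

lemma comp_eq_idem:
  assumes "x \<in> Ob C" "y \<in> Ob C" "x \<noteq> y" "f \<in> hom x y" "g \<in> hom y x"
  shows "g \<cdot> f = idem x"
  using idem(3) comp_ne_ident comp_in_hom assms by blast

text \<open>Factor the idempotent candidate through another object \<open>y\<close> as \<open>g \<cdot> f\<close>. Its square is
  \<open>g \<cdot> (f \<cdot> idem x)\<close>, again a composite \<open>x \<rightarrow> y \<rightarrow> x\<close>.\<close>

lemma idem_idem:
  assumes x: "x \<in> Ob C"
  shows "idem x \<cdot> idem x = idem x"
proof -
  obtain y where y: "y \<in> Ob C" "y \<noteq> x" using two_objects[OF x] by blast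
  obtain f g where f: "f \<in> hom x y" and g: "g \<in> hom y x" using hom_nonempty x y by blast
  have i: "g \<cdot> f = idem x" by (rule comp_eq_idem[OF x y(1) y(2)[symmetric] f g])
  have fi: "f \<cdot> idem x \<in> hom x y" using comp_in_hom[OF idem(1)[OF x] f] .
  have "idem x \<cdot> idem x = g \<cdot> (f \<cdot> idem x)" using comp_assoc[OF idem(1)[OF x] f g] i by simp
  also have "\<dots> = idem x" by (rule comp_eq_idem[OF x y(1) y(2)[symmetric] fi g])
  finally show ?thesis .
qed

text \<open>For \<open>x \<noteq> y\<close>, the composite \<open>f' \<cdot> g \<cdot> f\<close> with any \<open>g : y \<rightarrow> x\<close> can be read in two ways. As \<open>f\<close> and \<open>f'\<close> are
  arbitrary, both sides are independent of the morphism chosen, which makes \<open>zero\<close> below well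
  defined.\<close>

lemma comp_idem_eq:
  assumes x: "x \<in> Ob C" and y: "y \<in> Ob C" and f: "f \<in> hom x y" and f': "f' \<in> hom x y"
  shows "f' \<cdot> idem x = idem y \<cdot> f"
proof (cases "x = y")
  case True
  then show ?thesis
    using f f' idem[OF y] idem_idem[OF y] comp_ident_left comp_ident_right by metis
next
  case False
  obtain g where g: "g \<in> hom y x" using hom_nonempty x y by blast
  have "f' \<cdot> idem x = f' \<cdot> (g \<cdot> f)" using comp_eq_idem[OF x y False f g] by simp
  also have "\<dots> = (f' \<cdot> g) \<cdot> f" by (rule comp_assoc[OF f g f'])
  also have "f' \<cdot> g = idem y" by (rule comp_eq_idem[OF y x _ g f']) (use False in simp)
  finally show ?thesis .
qed

definition zero :: "'o \<Rightarrow> 'o \<Rightarrow> 'm" where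
  "zero x y = (SOME f. f \<in> hom x y) \<cdot> idem x"

lemma comp_idem:
  assumes x: "x \<in> Ob C" and y: "y \<in> Ob C" and f: "f \<in> hom x y"
  shows "f \<cdot> idem x = zero x y" "idem y \<cdot> f = zero x y"
proof -
  have s: "(SOME f. f \<in> hom x y) \<in> hom x y" using f by (rule someI)
  show "idem y \<cdot> f = zero x y" using comp_idem_eq[OF x y f s] by (simp add: zero_def)
  then show "f \<cdot> idem x = zero x y" using comp_idem_eq[OF x y f f] by simp
qed

lemma zero_in_hom: "x \<in> Ob C \<Longrightarrow> y \<in> Ob C \<Longrightarrow> zero x y \<in> hom x y"
  by (metis comp_idem(1) comp_in_hom hom_nonempty idem(1))

lemma zero_self: "x \<in> Ob C \<Longrightarrow> zero x x = idem x"
  by (metis comp_idem(1) idem(1) idem_idem)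

lemma comp_zero:
  assumes x: "x \<in> Ob C" and y: "y \<in> Ob C" and z: "z \<in> Ob C"
  shows "g \<in> hom y z \<Longrightarrow> g \<cdot> zero x y = zero x z" "f \<in> hom x y \<Longrightarrow> zero y z \<cdot> f = zero x z"
proof -
  assume g: "g \<in> hom y z"
  obtain f where f: "f \<in> hom x y" using hom_nonempty x y by blast
  show "g \<cdot> zero x y = zero x z"
    using comp_assoc[OF idem(1)[OF x] f g] comp_idem(1)[OF x y f]
      comp_idem(1)[OF x z comp_in_hom[OF f g]] by simp
next
  assume f: "f \<in> hom x y"
  obtain g where g: "g \<in> hom y z" using hom_nonempty y z by blast
  show "zero y z \<cdot> f = zero x z"
    using comp_assoc[OF f g idem(1)[OF z]] comp_idem(2)[OF y z g]
      comp_idem(2)[OF x z comp_in_hom[OF f g]] by simp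
qed

definition unit :: "'o \<Rightarrow> 'o \<Rightarrow> 'm" where
  "unit x y = (THE f. f \<in> hom x y \<and> f \<noteq> zero x y)"

lemma unit:
  assumes x: "x \<in> Ob C" and y: "y \<in> Ob C"
  shows "unit x y \<in> hom x y" "unit x y \<noteq> zero x y" "hom x y = {zero x y, unit x y}"
proof -
  obtain e where e: "e \<noteq> zero x y" "hom x y = {zero x y, e}"
    using hom_other[OF x y zero_in_hom[OF x y]] by blast
  have "unit x y = e" unfolding unit_def by (rule the_equality) (use e in auto)
  then show "unit x y \<in> hom x y" "unit x y \<noteq> zero x y" "hom x y = {zero x y, unit x y}"
    using e by auto
qed

lemma unit_self:
  assumes x: "x \<in> Ob C"
  shows "unit x x = one x"
proof -
  have "one x \<in> {zero x x, unit x x}" using ident_in_hom[OF x] unit(3)[OF x x] by simp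
  moreover have "one x \<noteq> zero x x" using idem(2)[OF x] zero_self[OF x] by simp
  ultimately show ?thesis by simp
qed

definition mor :: "'o \<Rightarrow> 'o \<Rightarrow> bool \<Rightarrow> 'm" where
  "mor x y b = (if b then unit x y else zero x y)"

lemma mor_in_hom: "\<lbrakk>x \<in> Ob C; y \<in> Ob C\<rbrakk> \<Longrightarrow> mor x y b \<in> hom x y"
  by (simp add: mor_def unit zero_in_hom)

lemma mor_eq_iff: "\<lbrakk>x \<in> Ob C; y \<in> Ob C\<rbrakk> \<Longrightarrow> mor x y b = mor x y c \<longleftrightarrow> b = c"
  using unit(2)[of x y] by (auto simp: mor_def)

lemma hom_cases: "\<lbrakk>x \<in> Ob C; y \<in> Ob C; f \<in> hom x y\<rbrakk> \<Longrightarrow> \<exists>b. f = mor x y b"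
  using unit(3)[of x y] by (auto simp: mor_def)

definition units_comp :: "'o \<Rightarrow> 'o \<Rightarrow> 'o \<Rightarrow> bool" where
  "units_comp x y z \<longleftrightarrow> unit y z \<cdot> unit x y = unit x z"

lemma comp_mor:
  assumes "x \<in> Ob C" "y \<in> Ob C" "z \<in> Ob C"
  shows "mor y z b' \<cdot> mor x y b = mor x z (b \<and> b' \<and> units_comp x y z)"
proof (cases "b \<and> b'")
  case True
  have "unit y z \<cdot> unit x y \<in> {zero x z, unit x z}"
    using unit assms comp_in_hom by metis
  then show ?thesis using True by (auto simp: mor_def units_comp_def)
next
  case False
  then show ?thesis using comp_zero assms unit zero_in_hom by (auto simp: mor_def)
qed

lemma units_comp_ident: "\<lbrakk>x \<in> Ob C; y \<in> Ob C\<rbrakk> \<Longrightarrow> units_comp x x y \<and> units_comp x y y"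
  by (simp add: units_comp_def unit_self comp_ident_left[OF unit(1)] comp_ident_right[OF unit(1)])

lemma not_units_comp_back: "\<lbrakk>x \<in> Ob C; y \<in> Ob C; x \<noteq> y\<rbrakk> \<Longrightarrow> \<not> units_comp x y x"
  by (simp add: units_comp_def unit_self comp_ne_ident unit)

lemma units_comp_assoc:
  assumes "w \<in> Ob C" "x \<in> Ob C" "y \<in> Ob C" "z \<in> Ob C"
  shows "units_comp w x y \<and> units_comp w y z \<longleftrightarrow> units_comp x y z \<and> units_comp w x z"
proof -
  have "mor y z True \<cdot> (mor x y True \<cdot> mor w x True) = (mor y z True \<cdot> mor x y True) \<cdot> mor w x True"
    by (rule comp_assoc) (use mor_in_hom assms in auto)
  then show ?thesis by (simp add: comp_mor mor_eq_iff assms)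
qed

lemma isomorphic_triple_cat:
  assumes l: "bij_betw l {1..n} (Ob C)"
  shows "\<exists>T. coherent n T \<and> isomorphic_cats (triple_cat n T) C"
proof -
  define T where "T = {(i, j, k) \<in> distinct_triples n. units_comp (l i) (l j) (l k)}"
  have lO: "l i \<in> Ob C" if "i \<in> {1..n}" for i using l that bij_betw_apply by metis
  have leq: "l i = l j \<longleftrightarrow> i = j" if "i \<in> {1..n}" "j \<in> {1..n}" for i j
    using that by (rule inj_on_eq_iff[OF bij_betw_imp_inj_on[OF l]])
  have uc: "units_compose T i j k \<longleftrightarrow> units_comp (l i) (l j) (l k)"
    if ijk: "i \<in> {1..n}" "j \<in> {1..n}" "k \<in> {1..n}" for i j k
  proof (cases "i = j \<or> j = k \<or> i = k")
    case True
    then consider "i = j \<or> j = k" | "i \<noteq> j" "k = i" by blast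
    then show ?thesis
    proof cases
      case 1
      then show ?thesis using units_comp_ident lO ijk by (auto simp: units_compose_def)
    next
      case 2
      then have "\<not> units_comp (l i) (l j) (l k)"
        using not_units_comp_back[of "l i" "l j"] lO leq ijk by simp
      then show ?thesis using 2 by (simp add: units_compose_def T_def)
    qed
  next
    case False
    then show ?thesis using ijk by (auto simp: units_compose_def T_def distinct_triples_def)
  qed
  have coh: "coherent n T"
    unfolding coherent_def
  proof (intro conjI ballI)
    show "T \<subseteq> distinct_triples n" by (auto simp: T_def)
  next
    fix i j k m assume *: "i \<in> {1..n}" "j \<in> {1..n}" "k \<in> {1..n}" "m \<in> {1..n}"
    then show "units_compose T i j k \<and> units_compose T i k m \<longleftrightarrow> units_compose T j k m \<and> units_compose T i j m"
      using units_comp_assoc[OF lO lO lO lO, OF *] by (simp only: uc *)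
  qed
  let ?K = "triple_cat n T"
  define F1 where "F1 f = mor (l (arrow_src f)) (l (arrow_trg f)) (arrow_flag f)" for f
  have F1: "F1 (arrow i j b) = mor (l i) (l j) b" for i j b by (simp add: F1_def)
  have F: "is_functor ?K C l F1"
    unfolding is_functor_def
  proof (intro conjI ballI)
    fix i assume "i \<in> Ob ?K"
    then show "F1 (ident ?K i) = one (l i)" using lO by (simp add: F1 mor_def unit_self)
  next
    fix i j k f g assume *: "i \<in> Ob ?K" "j \<in> Ob ?K" "k \<in> Ob ?K"
      "f \<in> hom_set ?K i j" "g \<in> hom_set ?K j k"
    then obtain b b' where "f = arrow i j b" "g = arrow j k b'"
      by (auto simp: hom_set_triple_cat)
    then show "F1 (cmp ?K g f) = F1 g \<cdot> F1 f" using * lO uc by (simp add: F1 comp_mor)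
  qed (use lO in \<open>auto simp: hom_set_triple_cat F1 mor_in_hom\<close>)
  have "bij_betw F1 (Mor ?K) (Mor C)"
    unfolding bij_betw_def
  proof (intro conjI inj_onI set_eqI iffI)
    fix f g assume fg: "f \<in> Mor ?K" "g \<in> Mor ?K" and eq: "F1 f = F1 g"
    obtain i j b i' j' b' where f: "f = arrow i j b" "i \<in> {1..n}" "j \<in> {1..n}"
      and g: "g = arrow i' j' b'" "i' \<in> {1..n}" "j' \<in> {1..n}"
      using fg by auto
    have "mor (l i) (l j) b \<in> hom (l i) (l j)" "mor (l i') (l j') b' \<in> hom (l i') (l j')"
      using f g lO mor_in_hom by auto
    then have "l i = l i' \<and> l j = l j'" using eq f g by (simp add: F1 hom_set_def)
    then have "i = i' \<and> j = j'" using leq f g by auto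
    then show "f = g" using eq f g lO mor_eq_iff by (simp add: F1)
  next
    fix f assume "f \<in> F1 ` Mor ?K"
    then obtain i j b where "i \<in> {1..n}" "j \<in> {1..n}" "f = mor (l i) (l j) b" by (auto simp: F1)
    then have "f \<in> hom (l i) (l j)" using mor_in_hom lO by simp
    then show "f \<in> Mor C" by (simp add: hom_set_def)
  next
    fix f assume f: "f \<in> Mor C"
    then have "src C f \<in> Ob C" "trg C f \<in> Ob C" using src_in_Ob trg_in_Ob by auto
    then obtain i j where ij: "i \<in> {1..n}" "j \<in> {1..n}" "src C f = l i" "trg C f = l j"
      using l by (metis bij_betw_imp_surj_on imageE)
    then have "f \<in> hom (l i) (l j)" using f by (simp add: hom_set_def)
    then obtain b where "f = mor (l i) (l j) b" using hom_cases lO ij by blast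
    then show "f \<in> F1 ` Mor ?K" using ij by (intro image_eqI[of _ _ "arrow i j b"]) (auto simp: F1)
  qed
  then show ?thesis using F l coh unfolding isomorphic_cats_def by (intro exI[of _ T]) auto
qed

end

lemma reduced_cats_triple_cat:
  assumes "n \<ge> 2" "C \<in> reduced_cats n M2"
  shows "\<exists>T. coherent n T \<and> isomorphic_cats (triple_cat n T) C"
proof -
  from assms(2) obtain l where cat: "category C" and red: "reduced C" and l: "bij_betw l {1..n} (Ob C)"
    and hom: "\<And>i j. i \<in> {1..n} \<Longrightarrow> j \<in> {1..n} \<Longrightarrow> card (hom_set C (l i) (l j)) = 2"
    unfolding reduced_cats_def associated_def M2_def by auto
  interpret category C by fact
  interpret two_hom_category C
  proof
    fix x y assume "x \<in> Ob C" "y \<in> Ob C"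
    then show "card (hom_set C x y) = 2"
      using hom unfolding bij_betw_imp_surj_on[OF l, symmetric] by blast
  next
    fix x assume "x \<in> Ob C"
    have "card (Ob C) = n" using l bij_betw_same_card by fastforce
    moreover have "card (Ob C) \<le> 1" if "Ob C \<subseteq> {x}" using card_mono[OF _ that] by simp
    ultimately have "\<not> Ob C \<subseteq> {x}" using assms(1) by linarith
    then show "\<exists>y\<in>Ob C. y \<noteq> x" by blast
  qed fact
  show ?thesis by (rule isomorphic_triple_cat[OF l])
qed

section \<open>Counting\<close>

text \<open>Going \<open>i \<rightarrow> j \<rightarrow> i \<rightarrow> k\<close>, one bracketing passes through the zero composite \<open>i \<rightarrow> j \<rightarrow> i\<close>, so the
  other, which is governed by \<open>(j, i, k)\<close> and \<open>(i, j, k)\<close>, must give zero too. The path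
  \<open>i \<rightarrow> j \<rightarrow> k \<rightarrow> j\<close> gives the second claim.\<close>

lemma coherent_triangle:
  assumes "coherent n T" "i \<in> {1..n}" "j \<in> {1..n}" "k \<in> {1..n}" "i \<noteq> j" "j \<noteq> k" "i \<noteq> k"
  shows "\<not> ((i, j, k) \<in> T \<and> (j, i, k) \<in> T)" "\<not> ((i, j, k) \<in> T \<and> (i, k, j) \<in> T)"
proof -
  have T: "T \<subseteq> distinct_triples n" using assms(1) by (simp add: coherent_def)
  have c: "units_compose T i j k \<and> units_compose T i k l
      \<longleftrightarrow> units_compose T j k l \<and> units_compose T i j l"
    if "i \<in> {1..n}" "j \<in> {1..n}" "k \<in> {1..n}" "l \<in> {1..n}" for i j k l
    using assms(1) that unfolding coherent_def by blast
  have no: "\<not> units_compose T i j i" "\<not> units_compose T j k j"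
    using T assms by (auto simp: units_compose_def distinct_triples_def)
  show "\<not> ((i, j, k) \<in> T \<and> (j, i, k) \<in> T)"
    using c[of i j i k] no assms by (auto simp: units_compose_def)
  show "\<not> ((i, j, k) \<in> T \<and> (i, k, j) \<in> T)"
    using c[of i j k j] no assms by (auto simp: units_compose_def)
qed

definition orderings :: "'a set \<Rightarrow> ('a \<times> 'a \<times> 'a) set" where
  "orderings S = {(i, j, k). i \<in> S \<and> j \<in> S \<and> k \<in> S \<and> i \<noteq> j \<and> j \<noteq> k \<and> i \<noteq> k}"

text \<open>Each of the two adjacent transpositions is an involution, and they are alternated around the
  hexagon of orderings; the sets below contain no two neighbours.\<close>

definition hexagon_independent :: "'a set \<Rightarrow> ('a \<times> 'a \<times> 'a) set set" where
  "hexagon_independent S = {U. U \<subseteq> orderings S \<and>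
     (\<forall>i j k. (i, j, k) \<in> U \<longrightarrow> (j, i, k) \<notin> U \<and> (i, k, j) \<notin> U)}"

lemma card_hexagon_independent:
  assumes "card S = 3"
  shows "finite (hexagon_independent S) \<and> card (hexagon_independent S) \<le> 18"
proof -
  obtain a b c where S: "S = {a, b, c}" "a \<noteq> b" "b \<noteq> c" "a \<noteq> c"
    using assms by (auto simp: card_3_iff)
  \<comment> \<open>The orderings are listed in the cyclic order of the hexagon, swapping alternately the first
    two and the last two entries.\<close>
  let ?good = "\<lambda>v. \<not> (v!0 \<and> v!1) \<and> \<not> (v!1 \<and> v!2) \<and> \<not> (v!2 \<and> v!3)
      \<and> \<not> (v!3 \<and> v!4) \<and> \<not> (v!4 \<and> v!5) \<and> \<not> (v!5 \<and> v!0)"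
  let ?V = "filter ?good (List.n_lists 6 [True, False])"
  define \<phi> where "\<phi> U = [(a,b,c) \<in> U, (b,a,c) \<in> U, (b,c,a) \<in> U, (c,b,a) \<in> U, (c,a,b) \<in> U, (a,c,b) \<in> U]" for U
  have ord: "orderings S = {(a,b,c), (b,a,c), (b,c,a), (c,b,a), (c,a,b), (a,c,b)}"
    using S by (auto simp: orderings_def)
  have "\<phi> U \<in> set ?V" if U: "U \<in> hexagon_independent S" for U
  proof -
    have ind: "(i, j, k) \<in> U \<Longrightarrow> (j, i, k) \<notin> U \<and> (i, k, j) \<notin> U" for i j k
      using U unfolding hexagon_independent_def by blast
    have "?good (\<phi> U)"
      using ind[of a b c] ind[of b c a] ind[of c a b] by (auto simp: \<phi>_def)
    moreover have "\<phi> U \<in> set (List.n_lists 6 [True, False])"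
      by (auto simp: \<phi>_def set_n_lists)
    ultimately show ?thesis by simp
  qed
  then have "\<phi> ` hexagon_independent S \<subseteq> set ?V" by blast
  moreover have "inj_on \<phi> (hexagon_independent S)"
  proof (rule inj_onI)
    fix U V assume UV: "U \<in> hexagon_independent S" "V \<in> hexagon_independent S" "\<phi> U = \<phi> V"
    have "t \<in> U \<longleftrightarrow> t \<in> V" if "t \<in> orderings S" for t
      using that UV(3) unfolding ord \<phi>_def by auto
    then show "U = V" using UV(1,2) unfolding hexagon_independent_def by blast
  qed
  moreover have "card (set ?V) \<le> 18"
  proof -
    have "length ?V = 18" by code_simp
    then show ?thesis using card_length[of ?V] by simp
  qed
  ultimately show ?thesis
    using card_inj_on_le[of \<phi> "hexagon_independent S" "set ?V"] inj_on_finite[of \<phi> "hexagon_independent S" "set ?V"]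
      le_trans[of _ "card (set ?V)" 18] by blast
qed

text \<open>A coherent set is determined by its traces on the 3-sets of indices, and each trace is an
  independent set of the hexagon. Coherence also constrains paths through four distinct
  indices, so this is in general only an inequality.\<close>

lemma card_coherent:
  "finite {T. coherent n T} \<and> card {T. coherent n T} \<le> 18 ^ (n choose 3)"
proof -
  let ?P = "{S. S \<subseteq> {1..n} \<and> card S = 3}"
  define \<phi> where "\<phi> T = (\<lambda>S \<in> ?P. T \<inter> orderings S)" for T :: "(nat \<times> nat \<times> nat) set"
  have fP: "finite ?P" by simp
  have fin: "finite (PiE ?P hexagon_independent)"
    using fP card_hexagon_independent by (intro finite_PiE) auto
  have "card (PiE ?P hexagon_independent) = (\<Prod>S \<in> ?P. card (hexagon_independent S))"
    by (rule card_PiE[OF fP])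
  also have "\<dots> \<le> (\<Prod>S \<in> ?P. 18)"
    using card_hexagon_independent by (intro prod_mono) auto
  also have "\<dots> = 18 ^ (n choose 3)" using n_subsets[of "{1..n}" 3] by simp
  finally have le: "card (PiE ?P hexagon_independent) \<le> 18 ^ (n choose 3)" .
  have img: "\<phi> ` {T. coherent n T} \<subseteq> PiE ?P hexagon_independent"
  proof (rule image_subsetI)
    fix T assume "T \<in> {T. coherent n T}"
    then have T: "coherent n T" by simp
    have "T \<inter> orderings S \<in> hexagon_independent S" if S: "S \<in> ?P" for S
      unfolding hexagon_independent_def
    proof (intro CollectI conjI allI impI)
      fix i j k assume t: "(i, j, k) \<in> T \<inter> orderings S"
      then have "i \<in> {1..n}" "j \<in> {1..n}" "k \<in> {1..n}" "i \<noteq> j" "j \<noteq> k" "i \<noteq> k"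
        using S by (auto simp: orderings_def)
      from coherent_triangle[OF T this] t
      show "(j, i, k) \<notin> T \<inter> orderings S" "(i, k, j) \<notin> T \<inter> orderings S" by blast+
    qed simp
    then show "\<phi> T \<in> PiE ?P hexagon_independent" unfolding \<phi>_def by (intro PiE_I) auto
  qed
  have inj: "inj_on \<phi> {T. coherent n T}"
  proof (rule inj_onI)
    fix T T' assume c: "T \<in> {T. coherent n T}" "T' \<in> {T. coherent n T}" and eq: "\<phi> T = \<phi> T'"
    have "t \<in> T \<longleftrightarrow> t \<in> T'" if t: "t \<in> distinct_triples n" for t
    proof -
      obtain i j k where ijk: "t = (i, j, k)" by (cases t)
      let ?S = "{i, j, k}"
      have "?S \<in> ?P" "t \<in> orderings ?S"
        using t ijk by (auto simp: distinct_triples_def orderings_def)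
      moreover have "\<phi> T ?S = \<phi> T' ?S" using eq by simp
      ultimately show ?thesis unfolding \<phi>_def by auto
    qed
    then show "T = T'" using c unfolding coherent_def by blast
  qed
  have "card {T. coherent n T} \<le> card (PiE ?P hexagon_independent)"
    by (rule card_inj_on_le[OF inj img fin])
  moreover have "finite {T. coherent n T}"
    using inj img fin by (meson finite_imageD finite_subset)
  ultimately show ?thesis using le by linarith
qed

lemma Card_reduced_upper:
  assumes "n \<ge> 2"
  shows "finite (reduced_cats n M2 // iso_rel n M2) \<and> Card_reduced n M2 \<le> 18 ^ (n choose 3)"
proof -
  define \<phi> where "\<phi> C = (SOME T. coherent n T \<and> isomorphic_cats (triple_cat n T) C)" for C :: "(nat, nat) cat"
  have \<phi>: "coherent n (\<phi> C) \<and> isomorphic_cats (triple_cat n (\<phi> C)) C" if "C \<in> reduced_cats n M2" for C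
    unfolding \<phi>_def by (rule someI_ex[OF reduced_cats_triple_cat[OF assms that]])
  have "(C, D) \<in> iso_rel n M2"
    if C: "C \<in> reduced_cats n M2" and D: "D \<in> reduced_cats n M2" and eq: "\<phi> C = \<phi> D" for C D
  proof -
    have "isomorphic_cats C (triple_cat n (\<phi> C))"
      using isomorphic_cats_sym category_triple_cat \<phi>[OF C] C
      by (auto simp: reduced_cats_def associated_def)
    then have "isomorphic_cats C D" using \<phi>[OF D] eq isomorphic_cats_trans by metis
    then show ?thesis using C D by (simp add: iso_rel_def)
  qed
  then have "finite (reduced_cats n M2 // iso_rel n M2) \<and>
      card (reduced_cats n M2 // iso_rel n M2) \<le> card {T. coherent n T}"
    using \<phi> card_coherent by (intro quotient_card_le[OF equiv_iso_rel, where \<phi> = \<phi>]) auto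
  then show ?thesis using card_coherent[of n] by (auto simp: Card_reduced_def)
qed

text \<open>The one-object case is a monoid of order 2, which is determined by whether its second
  element is idempotent.\<close>

lemma finite_classes_one: "finite (reduced_cats 1 M2 // iso_rel 1 M2)"
proof -
  define \<phi> where "\<phi> C \<longleftrightarrow> (\<exists>x \<in> Ob C. \<exists>e \<in> Mor C. e \<noteq> ident C x \<and> cmp C e e = e)" for C :: "(nat, nat) cat"
  have struct: "\<exists>x e. Ob C = {x} \<and> Mor C = {ident C x, e} \<and> e \<noteq> ident C x \<and> hom_set C x x = Mor C \<and>
      category C \<and> cmp C e e = (if \<phi> C then e else ident C x)" if red: "C \<in> reduced_cats 1 M2" for C
  proof -
    from red have cat: "category C" by (simp add: reduced_cats_def associated_def)
    interpret category C by fact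
    from red obtain l where l: "bij_betw l {1..1::nat} (Ob C)" "card (hom_set C (l 1) (l 1)) = 2"
      unfolding reduced_cats_def associated_def M2_def by auto
    define x where "x = l 1"
    have Ob: "Ob C = {x}" using l(1) by (auto simp: x_def bij_betw_def)
    have Mor: "hom_set C x x = Mor C" using Ob src_in_Ob trg_in_Ob by (auto simp: hom_set_def)
    obtain e where e: "Mor C = {ident C x, e}" "e \<noteq> ident C x"
    proof -
      have "card (Mor C) = 2" "ident C x \<in> Mor C"
        using l(2) ident_in_hom[of x] Ob unfolding x_def[symmetric] Mor by auto
      then obtain a b where ab: "Mor C = {a, b}" "a \<noteq> b" "ident C x \<in> {a, b}"
        by (auto simp: card_2_iff)
      show ?thesis
      proof (cases "ident C x = a")
        case True
        then show ?thesis using that[of b] ab by simp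
      next
        case False
        then show ?thesis using that[of a] ab by (simp add: insert_commute)
      qed
    qed
    have "cmp C e e \<in> {ident C x, e}" using comp_in_hom[of e x x e x] Mor e by simp
    then have "cmp C e e = (if \<phi> C then e else ident C x)" using e Ob by (auto simp: \<phi>_def)
    then show ?thesis using Ob Mor e cat by blast
  qed
  have "(C, D) \<in> iso_rel 1 M2"
    if C: "C \<in> reduced_cats 1 M2" and D: "D \<in> reduced_cats 1 M2" and eq: "\<phi> C = \<phi> D" for C D
  proof -
    obtain x e where x: "Ob C = {x}" "Mor C = {ident C x, e}" "e \<noteq> ident C x" "hom_set C x x = Mor C"
      "category C" "cmp C e e = (if \<phi> C then e else ident C x)" using struct[OF C] by blast
    obtain y d where y: "Ob D = {y}" "Mor D = {ident D y, d}" "d \<noteq> ident D y" "hom_set D y y = Mor D"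
      "category D" "cmp D d d = (if \<phi> D then d else ident D y)" using struct[OF D] by blast
    note cx = category.comp_ident_left[OF x(5), of _ x x] category.comp_ident_right[OF x(5), of _ x x]
    note cy = category.comp_ident_left[OF y(5), of _ y y] category.comp_ident_right[OF y(5), of _ y y]
    define F1 where "F1 f = (if f = e then d else ident D y)" for f
    have "is_functor C D (\<lambda>_. y) F1"
      using x(1-4) x(6) y(1-4) y(6) cx cy eq unfolding is_functor_def F1_def by auto
    moreover have "bij_betw (\<lambda>_. y) (Ob C) (Ob D)" using x y by (simp add: bij_betw_def)
    moreover have "bij_betw F1 (Mor C) (Mor D)"
      using x(2,3) y(2,3) by (auto simp: bij_betw_def F1_def inj_on_def)
    ultimately have "isomorphic_cats C D" unfolding isomorphic_cats_def by blast
    then show ?thesis using C D by (simp add: iso_rel_def)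
  qed
  then show ?thesis
    using quotient_card_le[OF equiv_iso_rel[of 1 M2], where B = UNIV and \<phi> = \<phi>] by auto
qed

text \<open>Two triples of \<open>T\<close> can never be used one after the other: the index they share
  would have to lie in two of the disjoint sets. Thus both bracketings give zero unless a
  unit involved is an identity.\<close>

lemma coherent_tripartite:
  assumes "T \<subseteq> A \<times> B \<times> D" "A \<union> B \<union> D \<subseteq> {1..n}" "A \<inter> B = {}" "B \<inter> D = {}" "A \<inter> D = {}"
  shows "coherent n T"
proof -
  have 1: "T \<subseteq> distinct_triples n" using assms unfolding distinct_triples_def by auto
  have mem: "a \<in> A \<and> b \<in> B \<and> d \<in> D" if "(a, b, d) \<in> T" for a b d using assms(1) that by auto
  have no: "\<not> ((i, j, k) \<in> T \<and> (i', k, l) \<in> T)" "\<not> ((j, k, l) \<in> T \<and> (i, j, l') \<in> T)"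
    "(i, j, k) \<in> T \<Longrightarrow> i \<noteq> j \<and> j \<noteq> k \<and> i \<noteq> k" for i j k l i' l'
    using mem assms(3-5) by blast+
  have "units_compose T i j k \<and> units_compose T i k l \<longleftrightarrow> units_compose T j k l \<and> units_compose T i j l"
    for i j k l
    unfolding units_compose_def
    using no(1)[of i j k i l] no(2)[of j k l i l] no(3)[of i j k] no(3)[of i k l] no(3)[of j k l]
      no(3)[of i j l]
    by (smt (verit))
  then show ?thesis using 1 unfolding coherent_def by blast
qed

lemma Card_reduced_lower:
  assumes "n \<ge> 1"
  shows "2 ^ ((n div 3) ^ 3) \<le> fact n * Card_reduced n M2"
proof -
  define m where "m = n div 3"
  let ?A = "{1..m}" and ?B = "{m+1..2*m}" and ?D = "{2*m+1..3*m}"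
  define L where "L = Pow (?A \<times> ?B \<times> ?D)"
  have coh: "coherent n T" if "T \<in> L" for T
    using that by (intro coherent_tripartite[of T ?A ?B ?D]) (auto simp: L_def m_def)
  have fin: "finite (reduced_cats n M2 // iso_rel n M2)"
  proof (cases "n = 1")
    case True
    then show ?thesis using finite_classes_one by simp
  next
    case False
    then show ?thesis using Card_reduced_upper assms by simp
  qed
  have "card L = 2 ^ (m ^ 3)"
    by (simp add: L_def card_Pow card_cartesian_product power3_eq_cube)
  moreover have "card L \<le> fact n * card (reduced_cats n M2 // iso_rel n M2)"
  proof (rule card_le_mult_quotient[OF equiv_iso_rel fin])
    fix T assume T: "T \<in> L"
    show "triple_cat n T \<in> reduced_cats n M2" by (rule triple_cat_in_reduced_cats[OF coh[OF T]])
    let ?relabel = "\<lambda>\<sigma>. (\<lambda>(i, j, k). (\<sigma> i, \<sigma> j, \<sigma> k)) ` T"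
    have "{T' \<in> L. (triple_cat n T, triple_cat n T') \<in> iso_rel n M2} \<subseteq> ?relabel ` {\<sigma>. \<sigma> permutes {1..n}}"
    proof
      fix T' assume "T' \<in> {T' \<in> L. (triple_cat n T, triple_cat n T') \<in> iso_rel n M2}"
      then have T': "T' \<in> L" "isomorphic_cats (triple_cat n T) (triple_cat n T')"
        by (auto simp: iso_rel_def)
      have "T \<subseteq> distinct_triples n" "T' \<subseteq> distinct_triples n"
        using coh T T'(1) by (auto simp: coherent_def)
      then obtain \<sigma> where "\<sigma> permutes {1..n}" "T' = ?relabel \<sigma>"
        using T'(2) by (rule triple_cat_iso_imp_relabelling)
      then show "T' \<in> ?relabel ` {\<sigma>. \<sigma> permutes {1..n}}" by blast
    qed
    moreover have fin_perm: "finite {\<sigma>. \<sigma> permutes {1..n}}" by (simp add: finite_permutations)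
    ultimately have "card {T' \<in> L. (triple_cat n T, triple_cat n T') \<in> iso_rel n M2}
        \<le> card {\<sigma>. \<sigma> permutes {1..n}}"
      by (rule surj_card_le[rotated])
    then show "card {T' \<in> L. (triple_cat n T, triple_cat n T') \<in> iso_rel n M2} \<le> fact n"
      by (simp add: card_permutations)
  qed
  ultimately show ?thesis by (simp add: m_def Card_reduced_def)
qed

theorem mainTheorem1:
  fixes n :: nat
  assumes "n \<ge> 1"
  shows "2 ^ ((n div 3) ^ 3) / fact n \<le> real (Card_reduced n M2)
    \<and> (n \<ge> 2 \<longrightarrow> Card_reduced n M2 \<le> 18 ^ (n choose 3))"
proof
  have "real (2 ^ ((n div 3) ^ 3)) \<le> real (fact n * Card_reduced n M2)"
    using Card_reduced_lower[OF assms] by (rule of_nat_mono)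
  then show "2 ^ ((n div 3) ^ 3) / fact n \<le> real (Card_reduced n M2)"
    by (simp add: divide_le_eq mult.commute)
  show "n \<ge> 2 \<longrightarrow> Card_reduced n M2 \<le> 18 ^ (n choose 3)"
    using Card_reduced_upper by blast
qed

end
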